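(* In a complete graph with $n$ nodes (with arbitrary thresholds $t_I,t_E$ and budget $\beta$), the MES problem can be solved in $O(n)$ time.
   Context: Let $G=(V,E)$ be a graph, $N(v)$ the neighborhood of $v$, $d(v)=|N(v)|$, and $t_I,t_E:V\to\{0,1,2,\dots\}$ thresholds with $0\le t_I(v)\le t_E(v)\le d(v)+1$. For $S\subseteq V$: $\mathsf{Evg}[S,0]=\mathsf{Inf}[S,0]=S$, and for $\tau\ge1$, $\mathsf{Evg}[S,\tau]=\mathsf{Evg}[S,\tau-1]\cup\{u:|N(u)\cap\mathsf{Evg}[S,\tau-1]|\ge t_E(u)\}$, $\mathsf{Inf}[S,\tau]=\mathsf{Inf}[S,\tau-1]\cup\{u:|N(u)\cap\mathsf{Evg}[S,\tau-1]|\ge t_I(u)\}$; at the first $\rho$ with $\mathsf{Evg}[S,\rho]=\mathsf{Evg}[S,\rho-1]$ set $\mathsf{Inf}[S]=\mathsf{Inf}[S,\rho]$. The MES problem: given $G$, $t_I$, $t_E$ and budget $\beta$, find $S\subseteq V$ with $|S|\le\beta$ maximizing $|\mathsf{Inf}[S]|$. *)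

theory Defs
  imports Main
begin

text \<open>A graph is given by its vertex set V and its neighbourhood function N.\<close>

fun Evg :: "'a set \<Rightarrow> ('a \<Rightarrow> 'a set) \<Rightarrow> ('a \<Rightarrow> nat) \<Rightarrow> 'a set \<Rightarrow> nat \<Rightarrow> 'a set" where
  "Evg V N tE S 0 = S"
| "Evg V N tE S (Suc \<tau>) =
     Evg V N tE S \<tau> \<union> {u \<in> V. card (N u \<inter> Evg V N tE S \<tau>) \<ge> tE u}"

fun InfAt :: "'a set \<Rightarrow> ('a \<Rightarrow> 'a set) \<Rightarrow> ('a \<Rightarrow> nat) \<Rightarrow> ('a \<Rightarrow> nat) \<Rightarrow> 'a set \<Rightarrow> nat \<Rightarrow> 'a set" where
  "InfAt V N tI tE S 0 = S"
| "InfAt V N tI tE S (Suc \<tau>) =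
     InfAt V N tI tE S \<tau> \<union> {u \<in> V. card (N u \<inter> Evg V N tE S \<tau>) \<ge> tI u}"

definition stab_time :: "'a set \<Rightarrow> ('a \<Rightarrow> 'a set) \<Rightarrow> ('a \<Rightarrow> nat) \<Rightarrow> 'a set \<Rightarrow> nat" where
  "stab_time V N tE S = (LEAST \<rho>. 1 \<le> \<rho> \<and> Evg V N tE S \<rho> = Evg V N tE S (\<rho> - 1))"

definition Influenced :: "'a set \<Rightarrow> ('a \<Rightarrow> 'a set) \<Rightarrow> ('a \<Rightarrow> nat) \<Rightarrow> ('a \<Rightarrow> nat) \<Rightarrow> 'a set \<Rightarrow> 'a set" where
  "Influenced V N tI tE S = InfAt V N tI tE S (stab_time V N tE S)"

definition is_MES_solution ::
  "'a set \<Rightarrow> ('a \<Rightarrow> 'a set) \<Rightarrow> ('a \<Rightarrow> nat) \<Rightarrow> ('a \<Rightarrow> nat) \<Rightarrow> nat \<Rightarrow> 'a set \<Rightarrow> bool" where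
  "is_MES_solution V N tI tE \<beta> S \<longleftrightarrow>
     S \<subseteq> V \<and> card S \<le> \<beta> \<and>
     (\<forall>S'. S' \<subseteq> V \<and> card S' \<le> \<beta> \<longrightarrow>
        card (Influenced V N tI tE S') \<le> card (Influenced V N tI tE S))"

definition complete_nbrs :: "nat \<Rightarrow> nat \<Rightarrow> nat set" where
  "complete_nbrs n v = {0..<n} - {v}"

section \<open>Unit-cost RAM model (natural-number registers, indirect addressing)\<close>

datatype instr =
    LoadC nat nat
  | Add nat nat nat
  | Sub nat nat nat      \<comment> \<open>m[a] := m[b] - m[c] (truncated)\<close>
  | LoadI nat nat
  | StoreI nat nat
  | Jz nat nat
  | Jmp nat
  | Halt

type_synonym config = "nat \<times> (nat \<Rightarrow> nat)"

fun exec :: "instr \<Rightarrow> config \<Rightarrow> config" where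
  "exec (LoadC a k) (pc, m) = (Suc pc, m(a := k))"
| "exec (Add a b c) (pc, m) = (Suc pc, m(a := m b + m c))"
| "exec (Sub a b c) (pc, m) = (Suc pc, m(a := m b - m c))"
| "exec (LoadI a b) (pc, m) = (Suc pc, m(a := m (m b)))"
| "exec (StoreI a b) (pc, m) = (Suc pc, m(m a := m b))"
| "exec (Jz r l) (pc, m) = ((if m r = 0 then l else Suc pc), m)"
| "exec (Jmp l) (pc, m) = (l, m)"
| "exec Halt (pc, m) = (pc, m)"

definition halted :: "instr list \<Rightarrow> config \<Rightarrow> bool" where
  "halted P c \<longleftrightarrow> length P \<le> fst c \<or> P ! fst c = Halt"

definition step :: "instr list \<Rightarrow> config \<Rightarrow> config" where
  "step P c = (if halted P c then c else exec (P ! fst c) c)"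

definition run :: "instr list \<Rightarrow> nat \<Rightarrow> config \<Rightarrow> config" where
  "run P k c = (step P ^^ k) c"

definition mes_input :: "nat \<Rightarrow> nat \<Rightarrow> (nat \<Rightarrow> nat) \<Rightarrow> (nat \<Rightarrow> nat) \<Rightarrow> config" where
  "mes_input n \<beta> tI tE =
     (0, \<lambda>a. if a = 0 then n else if a = 1 then \<beta>
             else if 2 \<le> a \<and> a < 2 + n then tI (a - 2)
             else if 2 + n \<le> a \<and> a < 2 + 2 * n then tE (a - (2 + n))
             else 0)"

definition mes_output :: "nat \<Rightarrow> config \<Rightarrow> nat set" where
  "mes_output n c = {i. i < n \<and> snd c (2 + i) \<noteq> 0}"

end

theory Submission
  imports Defs
begin

text \<open>In a complete graph a node outside the current set \<open>E\<close> of evangelists sees all of \<open>E\<close>, so only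
  \<open>|E|\<close> matters. Let \<open>e\<close> be the least number with \<open>e = n\<close> or \<open>\<beta> + |{v. tE v \<le> e}| \<le> e\<close>. By induction
  over the rounds, no seed set of size at most \<open>\<beta>\<close> produces more than \<open>e\<close> evangelists, hence none
  influences more than \<open>min n (\<beta> + |{v. tI v \<le> e}|)\<close> nodes. This bound is attained by the \<open>\<beta>\<close> nodes
  with the largest keys, where \<open>v\<close> has key \<open>tE v\<close> if \<open>tI v \<le> e\<close> and key \<open>n + 1\<close> otherwise: these nodes
  waste no seed on a node with \<open>tE v \<le> j\<close>, for any \<open>j < e\<close>, nor on one with \<open>tI v \<le> e\<close>, unless
  all nodes with \<open>tE v > j\<close>, respectively \<open>tI v > e\<close>, are seeds.

  All thresholds are at most \<open>n\<close>, so counting sort gives linear time: a histogram of \<open>tE\<close> yields \<open>e\<close>,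
  and from a histogram of the keys one reads off, for each key \<open>k\<close>, how many of the nodes with key \<open>k\<close>
  can be afforded after all nodes with larger keys.\<close>

section \<open>Structured programs for the RAM\<close>

datatype com = Block "instr list" | Seq com com | IfNz nat com | While nat com

fun csize :: "com \<Rightarrow> nat" where
  "csize (Block is) = length is"
| "csize (Seq c d) = csize c + csize d"
| "csize (IfNz r c) = Suc (csize c)"
| "csize (While r c) = csize c + 2"

fun compile :: "com \<Rightarrow> nat \<Rightarrow> instr list" where
  "compile (Block is) l = is"
| "compile (Seq c d) l = compile c l @ compile d (l + csize c)"
| "compile (IfNz r c) l = Jz r (l + csize c + 1) # compile c (l + 1)"
| "compile (While r c) l = Jz r (l + csize c + 2) # compile c (l + 1) @ [Jmp l]"

lemma length_compile [simp]: "length (compile c l) = csize c"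
  by (induction c arbitrary: l) auto

fun straight :: "instr \<Rightarrow> bool" where
  "straight (Jz r l) = False"
| "straight (Jmp l) = False"
| "straight Halt = False"
| "straight _ = True"

definition eff :: "instr \<Rightarrow> (nat \<Rightarrow> nat) \<Rightarrow> nat \<Rightarrow> nat" where
  "eff i m = snd (exec i (0, m))"

lemma eff_simps [simp]:
  "eff (LoadC a k) m = m(a := k)"
  "eff (Add a b c) m = m(a := m b + m c)"
  "eff (Sub a b c) m = m(a := m b - m c)"
  "eff (LoadI a b) m = m(a := m (m b))"
  "eff (StoreI a b) m = m(m a := m b)"
  by (simp_all add: eff_def)

lemma exec_straight: "straight i \<Longrightarrow> exec i (pc, m) = (Suc pc, eff i m)"
  by (cases i) (auto simp: eff_def)

inductive big :: "com \<Rightarrow> (nat \<Rightarrow> nat) \<Rightarrow> nat \<Rightarrow> (nat \<Rightarrow> nat) \<Rightarrow> bool" where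
  Block: "list_all straight is \<Longrightarrow> big (Block is) m (length is) (fold eff is m)"
| Seq: "big c m s m' \<Longrightarrow> big d m' t m'' \<Longrightarrow> big (Seq c d) m (s + t) m''"
| IfZ: "m r = 0 \<Longrightarrow> big (IfNz r c) m 1 m"
| IfNz: "m r \<noteq> 0 \<Longrightarrow> big c m t m' \<Longrightarrow> big (IfNz r c) m (1 + t) m'"
| WhileZ: "m r = 0 \<Longrightarrow> big (While r c) m 1 m"
| WhileNz: "m r \<noteq> 0 \<Longrightarrow> big c m s m' \<Longrightarrow> big (While r c) m' t m'' \<Longrightarrow>
    big (While r c) m (1 + s + 1 + t) m''"

lemma run_add: "run P (s + t) c = run P t (run P s c)"
  by (simp add: run_def add.commute[of s t] funpow_add)

lemma run_1: "run P (Suc 0) c = step P c"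
  by (simp add: run_def)

lemma step_at:
  "i \<noteq> Halt \<Longrightarrow> step (pre @ i # post) (length pre, m) = exec i (length pre, m)"
  by (simp add: step_def halted_def)

lemma run_straight:
  assumes "list_all straight is"
  shows "run (pre @ is @ post) (length is) (length pre, m) = (length pre + length is, fold eff is m)"
  using assms
proof (induction "is" arbitrary: pre m)
  case Nil
  then show ?case by (simp add: run_def)
next
  case (Cons i "is")
  have i: "straight i" and "i \<noteq> Halt" using Cons.prems by auto
  then have s: "run (pre @ (i # is) @ post) 1 (length pre, m) = (Suc (length pre), eff i m)"
    by (simp add: run_1 step_at exec_straight)
  have "run ((pre @ [i]) @ is @ post) (length is) (length (pre @ [i]), eff i m) =
      (length (pre @ [i]) + length is, fold eff is (eff i m))"
    using Cons.prems by (intro Cons.IH) auto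
  then show ?case
    using s run_add[of "pre @ (i # is) @ post" 1 "length is" "(length pre, m)"] by simp
qed

theorem compile_correct:
  assumes "big c m t m'"
  shows "run (pre @ compile c (length pre) @ post) t (length pre, m) = (length pre + csize c, m')"
  using assms
proof (induction arbitrary: pre post rule: big.induct)
  case (Block "is" m)
  then show ?case by (simp add: run_straight)
next
  case (Seq c m s m' d t m'')
  show ?case
    using Seq.IH(1)[of pre "compile d (length pre + csize c) @ post"]
      Seq.IH(2)[of "pre @ compile c (length pre)" post]
    by (simp add: run_add add.assoc)
next
  case (IfZ m r c)
  then show ?case by (simp add: run_1 step_at)
next
  case (IfNz m r c t m')
  show ?case
    using IfNz.IH[of "pre @ [Jz r (length pre + csize c + 1)]" post] IfNz.hyps(1)
    unfolding run_add by (simp add: run_1 step_at)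
next
  case (WhileZ m r c)
  then show ?case by (simp add: run_1 step_at)
next
  case (WhileNz m r c s m' t m'')
  let ?j = "Jz r (length pre + csize c + 2)"
  let ?P = "pre @ compile (While r c) (length pre) @ post"
  have 1: "run ?P 1 (length pre, m) = (Suc (length pre), m)"
    using WhileNz.hyps(1) by (simp add: run_1 step_at)
  have 2: "run ?P s (Suc (length pre), m) = (Suc (length pre) + csize c, m')"
    using WhileNz.IH(1)[of "pre @ [?j]" "Jmp (length pre) # post"] by simp
  have 3: "run ?P 1 (Suc (length pre) + csize c, m') = (length pre, m')"
    using step_at[of "Jmp (length pre)" "pre @ ?j # compile c (Suc (length pre))" post m']
    by (simp add: run_1)
  show ?case
    unfolding run_add 1 2 3 by (rule WhileNz.IH(2))
qed

definition ends :: "com \<Rightarrow> (nat \<Rightarrow> nat) \<Rightarrow> nat \<Rightarrow> ((nat \<Rightarrow> nat) \<Rightarrow> bool) \<Rightarrow> bool" where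
  "ends c m b Q \<longleftrightarrow> (\<exists>t m'. t \<le> b \<and> big c m t m' \<and> Q m')"

lemma ends_Block:
  "list_all straight is \<Longrightarrow> length is \<le> b \<Longrightarrow> Q (fold eff is m) \<Longrightarrow> ends (Block is) m b Q"
  unfolding ends_def using big.Block by blast

lemma ends_Seq:
  assumes "ends c m a R" and "\<And>m'. R m' \<Longrightarrow> ends d m' b Q"
  shows "ends (Seq c d) m (a + b) Q"
  using assms unfolding ends_def by (meson add_mono big.Seq)

lemma ends_IfNz:
  assumes "m r = 0 \<Longrightarrow> Q m" and "m r \<noteq> 0 \<Longrightarrow> ends c m b Q"
  shows "ends (IfNz r c) m (Suc b) Q"
proof (cases "m r = 0")
  case True
  then show ?thesis using assms(1) big.IfZ[of m r c] unfolding ends_def by fastforce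
next
  case False
  then obtain t m' where "t \<le> b" "big c m t m'" "Q m'"
    using assms(2) unfolding ends_def by blast
  then show ?thesis using False big.IfNz[of m r c t m'] unfolding ends_def by fastforce
qed

lemma ends_While:
  assumes "I 0 m"
    and body: "\<And>i m. i < k \<Longrightarrow> I i m \<Longrightarrow> m r \<noteq> 0 \<and> ends c m b (I (Suc i))"
    and exit: "\<And>m. I k m \<Longrightarrow> m r = 0 \<and> Q m"
  shows "ends (While r c) m ((b + 2) * k + 1) Q"
proof -
  have "ends (While r c) m ((b + 2) * j + 1) Q" if "j \<le> k" "I (k - j) m" for j m
    using that
  proof (induction j arbitrary: m)
    case 0
    then show ?case using exit[of m] big.WhileZ[of m r c] unfolding ends_def by fastforce
  next
    case (Suc j)
    have s: "Suc (k - Suc j) = k - j" using Suc.prems by simp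
    obtain t m' where t: "m r \<noteq> 0" "t \<le> b" "big c m t m'" "I (k - j) m'"
      using body[of "k - Suc j" m] Suc.prems unfolding ends_def s by auto
    obtain u m'' where "u \<le> (b + 2) * j + 1" "big (While r c) m' u m''" "Q m''"
      using Suc.IH[OF _ t(4)] Suc.prems unfolding ends_def by auto
    then show ?case
      using big.WhileNz[OF t(1,3)] t(2) unfolding ends_def
      by (intro exI[of _ "1 + t + 1 + u"] exI[of _ m'']) auto
  qed
  from this[of k m] assms(1) show ?thesis by simp
qed

lemma ends_mono:
  assumes "ends c m a R" "a \<le> b" "\<And>m'. R m' \<Longrightarrow> Q m'"
  shows "ends c m b Q"
  using assms unfolding ends_def by (meson le_trans)

section \<open>Spreading in complete graphs\<close>

context
  fixes n :: nat and tI tE :: "nat \<Rightarrow> nat"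
  assumes tI_le_tE: "\<And>v. v < n \<Longrightarrow> tI v \<le> tE v"
begin

abbreviation (input) "V \<equiv> {0..<n}"
abbreviation (input) "evg \<equiv> Evg V (complete_nbrs n) tE"
abbreviation (input) "inf_at \<equiv> InfAt V (complete_nbrs n) tI tE"
abbreviation (input) "infl \<equiv> Influenced V (complete_nbrs n) tI tE"

lemma Evg_subset: "S \<subseteq> V \<Longrightarrow> evg S \<tau> \<subseteq> V"
  by (induction \<tau>) auto

lemma card_complete_nbrs_Int:
  assumes "F \<subseteq> V" "u \<notin> F"
  shows "card (complete_nbrs n u \<inter> F) = card F"
proof -
  have "complete_nbrs n u \<inter> F = F" using assms by (auto simp: complete_nbrs_def)
  then show ?thesis by simp
qed

lemma Evg_subset_InfAt: "evg S \<tau> \<subseteq> inf_at S \<tau>"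
  by (induction \<tau>) (auto intro: order_trans[OF tI_le_tE])

lemma stab_time_props:
  assumes "S \<subseteq> V"
  obtains \<rho> where "stab_time V (complete_nbrs n) tE S = Suc \<rho>" "evg S (Suc \<rho>) = evg S \<rho>"
proof -
  have "\<exists>\<rho>. evg S (Suc \<rho>) = evg S \<rho>"
  proof (rule ccontr)
    assume "\<nexists>\<rho>. evg S (Suc \<rho>) = evg S \<rho>"
    then have ne: "evg S \<rho> \<noteq> evg S (Suc \<rho>)" for \<rho> by metis
    have strict: "evg S \<rho> \<subset> evg S (Suc \<rho>)" for \<rho>
      by (rule psubsetI[OF _ ne]) simp
    have "\<rho> \<le> card (evg S \<rho>)" for \<rho>
    proof (induction \<rho>)
      case (Suc \<rho>)
      have "finite (evg S (Suc \<rho>))"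
        by (rule finite_subset[OF Evg_subset[OF assms]]) simp
      from psubset_card_mono[OF this strict] Suc show ?case by linarith
    qed simp
    moreover have "card (evg S (Suc n)) \<le> n"
      using card_mono[OF _ Evg_subset[OF assms, of "Suc n"]] by simp
    ultimately show False by (meson le_trans not_less_eq_eq order_refl)
  qed
  then obtain \<rho> where "evg S (Suc \<rho>) = evg S \<rho>" by blast
  then have "1 \<le> Suc \<rho> \<and> evg S (Suc \<rho>) = evg S (Suc \<rho> - 1)" by (simp del: Evg.simps)
  from LeastI[of "\<lambda>\<rho>. 1 \<le> \<rho> \<and> evg S \<rho> = evg S (\<rho> - 1)", OF this]
  have *: "1 \<le> stab_time V (complete_nbrs n) tE S"
    "evg S (stab_time V (complete_nbrs n) tE S) = evg S (stab_time V (complete_nbrs n) tE S - 1)"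
    unfolding stab_time_def by blast+
  show ?thesis
    by (rule that[of "stab_time V (complete_nbrs n) tE S - 1"])
      (use * in \<open>simp_all del: Evg.simps\<close>)
qed

lemma card_infl_le:
  assumes S: "S \<subseteq> V" "card S \<le> \<beta>"
    and e: "e = n \<or> \<beta> + card {v \<in> V. tE v \<le> e} \<le> e"
  shows "card (infl S) \<le> min n (\<beta> + card {v \<in> V. tI v \<le> e})"
proof -
  have evg: "card (evg S \<tau>) \<le> e \<and> evg S \<tau> \<subseteq> S \<union> {v \<in> V. tE v \<le> e}" for \<tau>
  proof -
    have bound: "card X \<le> e" if "X \<subseteq> S \<union> {v \<in> V. tE v \<le> e}" for X
    proof -
      have "finite S" using S finite_subset by blast
      then have "card X \<le> card (S \<union> {v \<in> V. tE v \<le> e})"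
        using that by (intro card_mono) auto
      moreover have "\<dots> \<le> card S + card {v \<in> V. tE v \<le> e}" by (rule card_Un_le)
      moreover have "card (S \<union> {v \<in> V. tE v \<le> e}) \<le> card V" using S by (intro card_mono) auto
      ultimately show ?thesis using S e by auto
    qed
    show ?thesis
    proof (induction \<tau>)
      case 0
      then show ?case using bound[of S] by auto
    next
      case (Suc \<tau>)
      have "tE u \<le> e" if "tE u \<le> card (complete_nbrs n u \<inter> evg S \<tau>)" for u
      proof -
        have "card (complete_nbrs n u \<inter> evg S \<tau>) \<le> card (evg S \<tau>)"
          using Evg_subset[OF S(1)] by (intro card_mono) (auto intro: finite_subset)
        then show ?thesis using that Suc by linarith
      qed
      then have "evg S (Suc \<tau>) \<subseteq> S \<union> {v \<in> V. tE v \<le> e}" using Suc by auto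
      then show ?case using bound by blast
    qed
  qed
  have inf: "inf_at S \<tau> \<subseteq> S \<union> {v \<in> V. tI v \<le> e}" for \<tau>
  proof (induction \<tau>)
    case (Suc \<tau>)
    have "tI u \<le> e" if "tI u \<le> card (complete_nbrs n u \<inter> evg S \<tau>)" for u
    proof -
      have "card (complete_nbrs n u \<inter> evg S \<tau>) \<le> card (evg S \<tau>)"
        using Evg_subset[OF S(1)] by (intro card_mono) (auto intro: finite_subset)
      then show ?thesis using that evg[of \<tau>] by linarith
    qed
    then show ?case using Suc by auto
  qed auto
  have fin: "finite (S \<union> {v \<in> V. tI v \<le> e})" using S finite_subset by auto
  have "card (infl S) \<le> card (S \<union> {v \<in> V. tI v \<le> e})"
    unfolding Influenced_def by (rule card_mono[OF fin inf])
  moreover have "card (S \<union> {v \<in> V. tI v \<le> e}) \<le> card S + card {v \<in> V. tI v \<le> e}"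
    by (rule card_Un_le)
  moreover have "card (S \<union> {v \<in> V. tI v \<le> e}) \<le> card V" using S by (intro card_mono) auto
  ultimately show ?thesis using S by simp
qed

lemma card_infl_ge:
  assumes S: "S \<subseteq> V" and cS: "card S = min \<beta> n" and en: "e \<le> n"
    and less: "\<And>j. j < e \<Longrightarrow> j < \<beta> + card {v \<in> V. tE v \<le> j}"
    and topE: "\<And>j. j < e \<Longrightarrow> S \<subseteq> {v \<in> V. j < tE v} \<or> {v \<in> V. j < tE v} \<subseteq> S"
    and topI: "S \<subseteq> {v \<in> V. e < tI v} \<or> {v \<in> V. e < tI v} \<subseteq> S"
  shows "min n (\<beta> + card {v \<in> V. tI v \<le> e}) \<le> card (infl S)"
proof -
  have cup: "min n (\<beta> + card {v \<in> V. t v \<le> j}) \<le> card (S \<union> {v \<in> V. t v \<le> j})"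
    if "S \<subseteq> {v \<in> V. j < t v} \<or> {v \<in> V. j < t v} \<subseteq> S" for t :: "nat \<Rightarrow> nat" and j
    using that
  proof
    assume "S \<subseteq> {v \<in> V. j < t v}"
    then have "card (S \<union> {v \<in> V. t v \<le> j}) = card S + card {v \<in> V. t v \<le> j}"
      using finite_subset[OF S] by (intro card_Un_disjoint) auto
    then show ?thesis using cS by simp
  next
    assume "{v \<in> V. j < t v} \<subseteq> S"
    then have "S \<union> {v \<in> V. t v \<le> j} = V" using S by force
    then show ?thesis by simp
  qed
  obtain \<rho> where \<rho>: "stab_time V (complete_nbrs n) tE S = Suc \<rho>" "evg S (Suc \<rho>) = evg S \<rho>"
    using stab_time_props[OF S] .
  define F where "F = evg S \<rho>"
  have F: "F \<subseteq> V" unfolding F_def by (rule Evg_subset[OF S])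
  then have finF: "finite F" by (rule finite_subset) simp
  have SF: "S \<subseteq> F" unfolding F_def by (induction \<rho>) auto
  have closed: "card F < tE u" if "u \<in> V" "u \<notin> F" for u
    using \<rho>(2) that card_complete_nbrs_Int[OF F that(2)] unfolding F_def by fastforce
  have "e \<le> card F"
  proof (rule ccontr)
    assume "\<not> e \<le> card F"
    then have lt: "card F < e" by simp
    have "S \<union> {v \<in> V. tE v \<le> card F} \<subseteq> F" using SF closed by force
    then have "card (S \<union> {v \<in> V. tE v \<le> card F}) \<le> card F" by (rule card_mono[OF finF])
    then show False using cup[OF topE[OF lt]] less[OF lt] lt en by linarith
  qed
  have sub: "S \<union> {v \<in> V. tI v \<le> e} \<subseteq> infl S"
  proof
    fix u assume u: "u \<in> S \<union> {v \<in> V. tI v \<le> e}"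
    show "u \<in> infl S"
    proof (cases "u \<in> F")
      case True
      then show ?thesis using Evg_subset_InfAt[of S "Suc \<rho>"] \<rho>
        unfolding Influenced_def F_def by auto
    next
      case False
      then have "u \<in> V" "tI u \<le> card (complete_nbrs n u \<inter> F)"
        using u SF card_complete_nbrs_Int[OF F False] \<open>e \<le> card F\<close> by auto
      then show ?thesis unfolding Influenced_def \<rho>(1) F_def by simp
    qed
  qed
  have "infl S \<subseteq> V"
  proof -
    have "inf_at S \<tau> \<subseteq> V" for \<tau> using S by (induction \<tau>) auto
    then show ?thesis unfolding Influenced_def by blast
  qed
  then have "finite (infl S)" by (rule finite_subset) simp
  then have "card (S \<union> {v \<in> V. tI v \<le> e}) \<le> card (infl S)" using sub by (rule card_mono)
  then show ?thesis using cup[OF topI] by linarith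
qed

end

definition ranked_before :: "(nat \<Rightarrow> nat) \<Rightarrow> nat \<Rightarrow> nat \<Rightarrow> bool" where
  "ranked_before key i j \<longleftrightarrow> key j < key i \<or> key i = key j \<and> i < j"

definition rank :: "nat \<Rightarrow> (nat \<Rightarrow> nat) \<Rightarrow> nat \<Rightarrow> nat" where
  "rank n key j = card {i. i < n \<and> ranked_before key i j}"

lemma rank_less:
  assumes "i < n" "ranked_before key i j"
  shows "rank n key i < rank n key j"
  unfolding rank_def
proof (rule psubset_card_mono)
  show "{h. h < n \<and> ranked_before key h i} \<subset> {h. h < n \<and> ranked_before key h j}"
  proof
    show "{h. h < n \<and> ranked_before key h i} \<subseteq> {h. h < n \<and> ranked_before key h j}"
      using assms by (auto simp: ranked_before_def)
    show "{h. h < n \<and> ranked_before key h i} \<noteq> {h. h < n \<and> ranked_before key h j}"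
      using assms by (auto simp: ranked_before_def)
  qed
qed simp

lemma bij_betw_rank: "bij_betw (rank n key) {..<n} {..<n}"
proof -
  have "inj_on (rank n key) {..<n}"
  proof (rule inj_onI)
    fix i j assume "i \<in> {..<n}" "j \<in> {..<n}" "rank n key i = rank n key j"
    then show "i = j"
      using rank_less[of i n key j] rank_less[of j n key i]
      by (auto simp: ranked_before_def) (metis linorder_neqE_nat)
  qed
  moreover have "rank n key ` {..<n} \<subseteq> {..<n}"
  proof
    fix r assume "r \<in> rank n key ` {..<n}"
    then obtain j where j: "j < n" "r = rank n key j" by auto
    have "{i. i < n \<and> ranked_before key i j} \<subset> {..<n}"
      using j by (auto simp: ranked_before_def)
    from psubset_card_mono[OF _ this] show "r \<in> {..<n}" using j by (simp add: rank_def)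
  qed
  ultimately show ?thesis
    by (simp add: bij_betw_def endo_inj_surj)
qed

lemma card_rank_less: "card {j. j < n \<and> rank n key j < \<beta>} = min \<beta> n"
proof -
  let ?S = "{j. j < n \<and> rank n key j < \<beta>}"
  have "rank n key ` ?S = {..<min \<beta> n}"
  proof
    show "{..<min \<beta> n} \<subseteq> rank n key ` ?S"
    proof
      fix r assume r: "r \<in> {..<min \<beta> n}"
      then have "r \<in> rank n key ` {..<n}"
        using bij_betw_imp_surj_on[OF bij_betw_rank] by auto
      then show "r \<in> rank n key ` ?S" using r by auto
    qed
    show "rank n key ` ?S \<subseteq> {..<min \<beta> n}"
      using bij_betw_imp_surj_on[OF bij_betw_rank[of n key]] by auto
  qed
  moreover have "inj_on (rank n key) ?S"
    using bij_betw_imp_inj_on[OF bij_betw_rank[of n key]] by (rule inj_on_subset) auto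
  ultimately show ?thesis by (metis card_image card_lessThan)
qed

lemma rank_less_comparable:
  "{j. j < n \<and> rank n key j < \<beta>} \<subseteq> {v. v < n \<and> k < key v} \<or>
   {v. v < n \<and> k < key v} \<subseteq> {j. j < n \<and> rank n key j < \<beta>}"
proof (rule ccontr)
  assume "\<not> ?thesis"
  then obtain i j where "j < n" "rank n key j < \<beta>" "\<not> k < key j"
    "i < n" "k < key i" "\<not> rank n key i < \<beta>" by auto
  then show False using rank_less[of i n key j] by (simp add: ranked_before_def)
qed

lemma rank_eq:
  assumes "j < n"
  shows "rank n key j = card {i. i < n \<and> key j < key i} + card {i. i < j \<and> key i = key j}"
proof -
  have "{i. i < n \<and> ranked_before key i j} =
      {i. i < n \<and> key j < key i} \<union> {i. i < j \<and> key i = key j}"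
    using assms by (auto simp: ranked_before_def)
  then show ?thesis
    unfolding rank_def by (simp add: card_Un_disjoint disjoint_iff)
qed

text \<open>As \<open>tI \<le> tE\<close>, the top key for nodes with \<open>tI v > e\<close>
  keeps all the sets \<open>{v. j < tE v}\<close> with \<open>j < e\<close> final segments of the key order.\<close>

lemma is_MES_solution_rank_less:
  assumes t: "\<And>v. v < n \<Longrightarrow> tI v \<le> tE v \<and> tE v \<le> n"
    and e: "e \<le> n" "e = n \<or> \<beta> + card {v. v < n \<and> tE v \<le> e} \<le> e"
    and less: "\<And>j. j < e \<Longrightarrow> j < \<beta> + card {v. v < n \<and> tE v \<le> j}"
    and key: "\<And>v. v < n \<Longrightarrow> key v = (if tI v \<le> e then tE v else Suc n)"
  shows "is_MES_solution {0..<n} (complete_nbrs n) tI tE \<beta> {j. j < n \<and> rank n key j < \<beta>}"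
proof -
  let ?S = "{j. j < n \<and> rank n key j < \<beta>}"
  have V: "{v \<in> {0..<n}. Q v} = {v. v < n \<and> Q v}" for Q by auto
  have topE: "{v. v < n \<and> j < key v} = {v. v < n \<and> j < tE v}" if "j < e" for j
    using that e(1) t by (auto simp: key split: if_splits) (meson le_trans less_le_trans not_le less_imp_le)
  have topI: "{v. v < n \<and> n < key v} = {v. v < n \<and> e < tI v}"
    using t by (auto simp: key leD split: if_splits)
  have "min n (\<beta> + card {v \<in> {0..<n}. tI v \<le> e})
      \<le> card (Influenced {0..<n} (complete_nbrs n) tI tE ?S)"
  proof (rule card_infl_ge)
    show "?S \<subseteq> {v \<in> {0..<n}. j < tE v} \<or> {v \<in> {0..<n}. j < tE v} \<subseteq> ?S" if "j < e" for j
      using rank_less_comparable[of n key \<beta> j] unfolding topE[OF that] V .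
    show "?S \<subseteq> {v \<in> {0..<n}. e < tI v} \<or> {v \<in> {0..<n}. e < tI v} \<subseteq> ?S"
      using rank_less_comparable[of n key \<beta> n] unfolding topI V .
  qed (use t e less in \<open>auto simp: V card_rank_less\<close>)
  moreover have "card (Influenced {0..<n} (complete_nbrs n) tI tE S)
      \<le> min n (\<beta> + card {v \<in> {0..<n}. tI v \<le> e})" if "S \<subseteq> {0..<n}" "card S \<le> \<beta>" for S
    using that e t by (intro card_infl_le) (auto simp: V)
  ultimately have "card (Influenced {0..<n} (complete_nbrs n) tI tE S)
      \<le> card (Influenced {0..<n} (complete_nbrs n) tI tE ?S)" if "S \<subseteq> {0..<n}" "card S \<le> \<beta>" for S
    using that le_trans by blast
  moreover have "?S \<subseteq> {0..<n}" by auto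
  ultimately show ?thesis
    unfolding is_MES_solution_def card_rank_less by (meson min.cobounded1)
qed

section \<open>The RAM program\<close>

text \<open>In the program fragments register 0 holds the constant 1, register 1 the base address \<open>D\<close> of the
  relocated input (\<open>tI\<close> at \<open>D + 1\<close>, \<open>tE\<close> and later the keys at \<open>D + 1 + n\<close>), register 2 holds \<open>n\<close>,
  register 9 the budget, register 10 the base address of the current histogram, and register 12
  the number \<open>e\<close>.\<close>

definition copy_loop :: com where
  "copy_loop = While 7 (Block
    [LoadI 8 5, StoreI 6 8, Add 5 5 0, Add 6 6 0, Sub 7 7 0])"

definition hist_prog :: com where
  "hist_prog = Seq
    (Block [Add 5 1 0, Add 5 5 2, LoadC 7 0, Add 7 7 2])
    (While 7 (Block
      [LoadI 8 5, Add 8 8 10, LoadI 11 8, Add 11 11 0, StoreI 8 11, Add 5 5 0, Sub 7 7 0]))"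

definition estar_prog :: com where
  "estar_prog = Seq
    (Block [LoadC 12 0, LoadI 4 10, Add 4 4 9, LoadC 7 0, Add 7 7 2])
    (While 7 (Seq (Block [Sub 7 7 0, Sub 8 4 12])
      (IfNz 8 (Block [Add 12 12 0, Add 8 10 12, LoadI 8 8, Add 4 4 8]))))"

definition key_prog :: com where
  "key_prog = Seq
    (Block [Add 6 1 0, Add 5 6 2, LoadC 7 0, Add 7 7 2])
    (While 7 (Seq (Block [LoadI 8 6, Sub 8 8 12, LoadI 11 5, Sub 7 7 0])
      (Seq (IfNz 8 (Block [Add 11 2 0])) (Block [StoreI 5 11, Add 5 5 0, Add 6 6 0]))))"

definition quota_prog :: com where
  "quota_prog = Seq
    (Block [Add 8 10 2, Add 8 8 0, LoadC 7 2, Add 7 7 2])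
    (While 7 (Block [LoadI 11 8, StoreI 8 9, Sub 9 9 11, Sub 8 8 0, Sub 7 7 0]))"

definition select_prog :: com where
  "select_prog = Seq
    (Block [Add 6 1 0, Add 5 6 2, LoadC 7 0, Add 7 7 2])
    (While 7 (Block
      [LoadI 8 5, Add 8 8 10, LoadI 11 8, StoreI 6 11, Sub 11 11 0, StoreI 8 11,
       Add 5 5 0, Add 6 6 0, Sub 7 7 0]))"

lemma copy_loop_ends:
  assumes "m 0 = 1" "m 5 = s" "m 6 = d" "m 7 = c" "12 < s" "12 < d" "s + c \<le> d \<or> d + c \<le> s"
  shows "ends copy_loop m (7 * c + 1)
    (\<lambda>m'. \<forall>x. x \<notin> {5, 6, 7, 8} \<longrightarrow> m' x = (if d \<le> x \<and> x < d + c then m (s + (x - d)) else m x))"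
proof -
  define I where "I i m' \<longleftrightarrow> m' 5 = s + i \<and> m' 6 = d + i \<and> m' 7 = c - i \<and>
    (\<forall>x. x \<notin> {5, 6, 7, 8} \<longrightarrow> m' x = (if d \<le> x \<and> x < d + i then m (s + (x - d)) else m x))"
    for i and m' :: "nat \<Rightarrow> nat"
  have "ends copy_loop m ((5 + 2) * c + 1)
    (\<lambda>m'. \<forall>x. x \<notin> {5, 6, 7, 8} \<longrightarrow> m' x = (if d \<le> x \<and> x < d + c then m (s + (x - d)) else m x))"
    unfolding copy_loop_def
  proof (rule ends_While[where I = I])
    show "I 0 m" using assms by (simp add: I_def)
    fix i m' assume i: "i < c" and I: "I i m'"
    have r: "m' 5 = s + i" "m' 6 = d + i" "m' 7 = c - i" "m' 0 = 1" "m' (s + i) = m (s + i)"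
      and fr: "\<And>x. x \<notin> {5, 6, 7, 8} \<Longrightarrow> m' x = (if d \<le> x \<and> x < d + i then m (s + (x - d)) else m x)"
      using I i assms by (auto simp: I_def)
    show "m' 7 \<noteq> 0 \<and> ends (Block [LoadI 8 5, StoreI 6 8, Add 5 5 0, Add 6 6 0, Sub 7 7 0]) m' 5 (I (Suc i))"
    proof
      show "m' 7 \<noteq> 0" using r i by simp
      show "ends (Block [LoadI 8 5, StoreI 6 8, Add 5 5 0, Add 6 6 0, Sub 7 7 0]) m' 5 (I (Suc i))"
        by (rule ends_Block) (use i assms in \<open>auto simp: I_def r fr\<close>)
    qed
  qed (auto simp: I_def)
  then show ?thesis by (rule ends_mono) simp_all
qed

lemma card_Collect_less_Suc:
  "card {j. j < Suc i \<and> P j} = card {j. j < i \<and> P j} + (if P i then 1 else 0)"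
proof -
  have "{j. j < Suc i \<and> P j} = (if P i then insert i {j. j < i \<and> P j} else {j. j < i \<and> P j})"
    by (auto simp: less_Suc_eq)
  then show ?thesis by simp
qed

lemma hist_prog_ends:
  assumes m: "m 0 = 1" "m 1 = D" "m 2 = n" "m 10 = H" and "12 < D" "D + 2 * n < H"
    and f: "\<And>j. j < n \<Longrightarrow> m (D + 1 + n + j) = f j" "\<And>j. j < n \<Longrightarrow> f j < L"
    and zero: "\<And>k. k < L \<Longrightarrow> m (H + k) = 0"
  shows "ends hist_prog m (9 * n + 5) (\<lambda>m'.
    (\<forall>x. x \<notin> {5, 7, 8, 11} \<and> \<not> (H \<le> x \<and> x < H + L) \<longrightarrow> m' x = m x) \<and>
    (\<forall>k < L. m' (H + k) = card {j. j < n \<and> f j = k}))" (is "ends _ _ _ ?Q")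
proof -
  define I where "I i m' \<longleftrightarrow> m' 5 = D + 1 + n + i \<and> m' 7 = n - i \<and>
    (\<forall>x. x \<notin> {5, 7, 8, 11} \<and> \<not> (H \<le> x \<and> x < H + L) \<longrightarrow> m' x = m x) \<and>
    (\<forall>k < L. m' (H + k) = card {j. j < i \<and> f j = k})" for i and m' :: "nat \<Rightarrow> nat"
  have "ends hist_prog m (4 + ((7 + 2) * n + 1)) ?Q"
    unfolding hist_prog_def
  proof (rule ends_Seq)
    show "ends (Block [Add 5 1 0, Add 5 5 2, LoadC 7 0, Add 7 7 2]) m 4 (I 0)"
      by (rule ends_Block) (use assms in \<open>auto simp: I_def\<close>)
    fix m1 assume I0: "I 0 m1"
    show "ends (While 7 (Block
      [LoadI 8 5, Add 8 8 10, LoadI 11 8, Add 11 11 0, StoreI 8 11, Add 5 5 0, Sub 7 7 0])) m1 ((7 + 2) * n + 1) ?Q"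
      (is "ends (While 7 ?c) _ _ _")
    proof (rule ends_While[where I = I])
      show "I 0 m1" by (rule I0)
      fix i m' assume i: "i < n" and I: "I i m'"
      have r: "m' 5 = D + 1 + n + i" "m' 7 = n - i" "m' 0 = 1" "m' 10 = H"
        "m' (D + 1 + n + i) = f i" "m' (H + f i) = card {j. j < i \<and> f j = f i}"
        and fr: "\<And>x. x \<notin> {5, 7, 8, 11} \<Longrightarrow> \<not> (H \<le> x \<and> x < H + L) \<Longrightarrow> m' x = m x"
        and h: "\<And>k. k < L \<Longrightarrow> m' (H + k) = card {j. j < i \<and> f j = k}"
        using I i assms by (auto simp: I_def)
      have "I (Suc i) (fold eff [LoadI 8 5, Add 8 8 10, LoadI 11 8, Add 11 11 0, StoreI 8 11, Add 5 5 0, Sub 7 7 0] m')"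
        using i assms(5,6) f(2)[OF i]
        by (auto simp: I_def r[simplified] fr h card_Collect_less_Suc add.commute[of _ H])
      then show "m' 7 \<noteq> 0 \<and> ends ?c m' 7 (I (Suc i))"
        using i r by (auto intro!: ends_Block)
    qed (auto simp: I_def)
  qed
  then show ?thesis by (rule ends_mono) simp_all
qed

lemma estar_prog_ends:
  assumes m: "m 0 = 1" "m 2 = n" "m 9 = \<beta>" "m 10 = H" and "12 < H"
    and h: "\<And>k. k \<le> n \<Longrightarrow> m (H + k) = card {j. j < n \<and> f j = k}"
  shows "ends estar_prog m (9 * n + 6) (\<lambda>m'.
    (\<forall>x. x \<notin> {4, 7, 8, 12} \<longrightarrow> m' x = m x) \<and> m' 12 \<le> n \<and>
    (m' 12 = n \<or> \<beta> + card {j. j < n \<and> f j \<le> m' 12} \<le> m' 12) \<and>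
    (\<forall>k < m' 12. k < \<beta> + card {j. j < n \<and> f j \<le> k}))" (is "ends _ _ _ ?Q")
proof -
  define I where "I i m' \<longleftrightarrow> m' 7 = n - i \<and> (\<forall>x. x \<notin> {4, 7, 8, 12} \<longrightarrow> m' x = m x) \<and>
    m' 4 = \<beta> + card {j. j < n \<and> f j \<le> m' 12} \<and> m' 12 \<le> i \<and>
    (m' 12 = i \<or> m' 4 \<le> m' 12) \<and>
    (\<forall>k < m' 12. k < \<beta> + card {j. j < n \<and> f j \<le> k})" for i and m' :: "nat \<Rightarrow> nat"
  have le_Suc: "card {j. j < n \<and> f j \<le> Suc k} = card {j. j < n \<and> f j \<le> k} + card {j. j < n \<and> f j = Suc k}" for k
  proof -
    have "{j. j < n \<and> f j \<le> Suc k} = {j. j < n \<and> f j \<le> k} \<union> {j. j < n \<and> f j = Suc k}" by auto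
    then show ?thesis by (simp add: card_Un_disjoint disjoint_iff)
  qed
  have "ends estar_prog m (5 + ((2 + Suc 4 + 2) * n + 1)) ?Q"
    unfolding estar_prog_def
  proof (rule ends_Seq)
    show "ends (Block [LoadC 12 0, LoadI 4 10, Add 4 4 9, LoadC 7 0, Add 7 7 2]) m 5 (I 0)"
      by (rule ends_Block) (use assms h[of 0] in \<open>auto simp: I_def\<close>)
    fix m1 assume I0: "I 0 m1"
    show "ends (While 7 (Seq (Block [Sub 7 7 0, Sub 8 4 12])
      (IfNz 8 (Block [Add 12 12 0, Add 8 10 12, LoadI 8 8, Add 4 4 8])))) m1 ((2 + Suc 4 + 2) * n + 1) ?Q"
    proof (rule ends_While[where I = I], rule I0, rule conjI)
      fix i m' assume i: "i < n" and I: "I i m'"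
      show "m' 7 \<noteq> 0" using i I by (simp add: I_def)
      have r: "m' 7 = n - i" "m' 0 = 1" "m' 10 = H"
        using I i assms by (auto simp: I_def)
      show "ends (Seq (Block [Sub 7 7 0, Sub 8 4 12])
        (IfNz 8 (Block [Add 12 12 0, Add 8 10 12, LoadI 8 8, Add 4 4 8]))) m' (2 + Suc 4) (I (Suc i))"
      proof (rule ends_Seq)
        show "ends (Block [Sub 7 7 0, Sub 8 4 12]) m' 2 (\<lambda>m2. m2 = m'(7 := n - Suc i, 8 := m' 4 - m' 12))"
          by (rule ends_Block) (auto simp: r)
        fix m2 assume m2: "m2 = m'(7 := n - Suc i, 8 := m' 4 - m' 12)"
        show "ends (IfNz 8 (Block [Add 12 12 0, Add 8 10 12, LoadI 8 8, Add 4 4 8])) m2 (Suc 4) (I (Suc i))"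
        proof (rule ends_IfNz)
          assume "m2 8 = 0"
          then show "I (Suc i) m2" using I by (auto simp: I_def m2)
        next
          assume "m2 8 \<noteq> 0"
          then have lt: "m' 12 < m' 4" by (simp add: m2)
          then have k: "m' 12 = i" using I by (auto simp: I_def)
          have hi: "m' (Suc (H + i)) = card {j. j < n \<and> f j = Suc i}"
            using I h[of "Suc i"] i assms(5) by (auto simp: I_def)
          show "ends (Block [Add 12 12 0, Add 8 10 12, LoadI 8 8, Add 4 4 8]) m2 4 (I (Suc i))"
            by (rule ends_Block)
              (use I lt assms(5) in \<open>auto simp: I_def m2 r k hi le_Suc less_Suc_eq\<close>)
        qed
      qed
    qed (auto simp: I_def)
  qed
  then show ?thesis by (rule ends_mono) simp_all
qed

lemma key_prog_ends:
  assumes m: "m 0 = 1" "m 1 = D" "m 2 = n" "m 12 = e" and "12 < D"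
    and tI: "\<And>j. j < n \<Longrightarrow> m (D + 1 + j) = tI j"
    and tE: "\<And>j. j < n \<Longrightarrow> m (D + 1 + n + j) = tE j"
  shows "ends key_prog m (11 * n + 5) (\<lambda>m'.
    (\<forall>x. x \<notin> {5, 6, 7, 8, 11} \<and> \<not> (D + 1 + n \<le> x \<and> x < D + 1 + 2 * n) \<longrightarrow> m' x = m x) \<and>
    (\<forall>j < n. m' (D + 1 + n + j) = (if tI j \<le> e then tE j else Suc n)))" (is "ends _ _ _ ?Q")
proof -
  define I where "I i m' \<longleftrightarrow> m' 5 = D + 1 + n + i \<and> m' 6 = D + 1 + i \<and> m' 7 = n - i \<and>
    (\<forall>x. x \<notin> {5, 6, 7, 8, 11} \<and> \<not> (D + 1 + n \<le> x \<and> x < D + 1 + n + i) \<longrightarrow> m' x = m x) \<and>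
    (\<forall>j < i. m' (D + 1 + n + j) = (if tI j \<le> e then tE j else Suc n))" for i and m' :: "nat \<Rightarrow> nat"
  have "ends key_prog m (4 + ((4 + (Suc 1 + 3) + 2) * n + 1)) ?Q"
    unfolding key_prog_def
  proof (rule ends_Seq)
    show "ends (Block [Add 6 1 0, Add 5 6 2, LoadC 7 0, Add 7 7 2]) m 4 (I 0)"
      by (rule ends_Block) (use assms in \<open>auto simp: I_def\<close>)
    fix m1 assume I0: "I 0 m1"
    show "ends (While 7 (Seq (Block [LoadI 8 6, Sub 8 8 12, LoadI 11 5, Sub 7 7 0])
      (Seq (IfNz 8 (Block [Add 11 2 0])) (Block [StoreI 5 11, Add 5 5 0, Add 6 6 0])))) m1
      ((4 + (Suc 1 + 3) + 2) * n + 1) ?Q"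
    proof (rule ends_While[where I = I], rule I0, rule conjI)
      fix i m' assume i: "i < n" and I: "I i m'"
      show "m' 7 \<noteq> 0" using i I by (simp add: I_def)
      have r: "m' 5 = D + 1 + n + i" "m' 6 = D + 1 + i" "m' 7 = n - i" "m' 0 = 1" "m' 2 = n"
        "m' 12 = e" "m' (D + 1 + i) = tI i" "m' (D + 1 + n + i) = tE i"
        and fr: "\<And>x. x \<notin> {5, 6, 7, 8, 11} \<Longrightarrow> \<not> (D + 1 + n \<le> x \<and> x < D + 1 + n + i) \<Longrightarrow> m' x = m x"
        and ke: "\<And>j. j < i \<Longrightarrow> m' (D + 1 + n + j) = (if tI j \<le> e then tE j else Suc n)"
        using I i assms by (auto simp: I_def)
      let ?m2 = "m'(8 := tI i - e, 11 := tE i, 7 := n - Suc i)"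
      let ?m3 = "?m2(11 := if tI i \<le> e then tE i else Suc n)"
      show "ends (Seq (Block [LoadI 8 6, Sub 8 8 12, LoadI 11 5, Sub 7 7 0])
        (Seq (IfNz 8 (Block [Add 11 2 0])) (Block [StoreI 5 11, Add 5 5 0, Add 6 6 0]))) m'
        (4 + (Suc 1 + 3)) (I (Suc i))"
      proof (rule ends_Seq)
        show "ends (Block [LoadI 8 6, Sub 8 8 12, LoadI 11 5, Sub 7 7 0]) m' 4 (\<lambda>m2. m2 = ?m2)"
          by (rule ends_Block) (use assms(5) in \<open>auto simp: r[simplified]\<close>)
        fix m2 assume m2: "m2 = ?m2"
        show "ends (Seq (IfNz 8 (Block [Add 11 2 0])) (Block [StoreI 5 11, Add 5 5 0, Add 6 6 0])) m2
          (Suc 1 + 3) (I (Suc i))"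
        proof (rule ends_Seq)
          show "ends (IfNz 8 (Block [Add 11 2 0])) m2 (Suc 1) (\<lambda>m3. m3 = ?m3)"
            by (rule ends_IfNz) (auto simp: m2 r fun_eq_iff intro!: ends_Block)
          fix m3 assume m3: "m3 = ?m3"
          show "ends (Block [StoreI 5 11, Add 5 5 0, Add 6 6 0]) m3 3 (I (Suc i))"
            by (rule ends_Block)
              (use i assms(5) in \<open>auto simp: I_def m3 r[simplified] fr ke[simplified] less_Suc_eq\<close>)
        qed
      qed
    qed (auto simp: I_def)
  qed
  then show ?thesis by (rule ends_mono) simp_all
qed

lemma quota_prog_ends:
  assumes m: "m 0 = 1" "m 2 = n" "m 9 = \<beta>" "m 10 = H" and "12 < H"
    and key: "\<And>j. j < n \<Longrightarrow> key j \<le> Suc n"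
    and h: "\<And>k. k < n + 2 \<Longrightarrow> m (H + k) = card {j. j < n \<and> key j = k}"
  shows "ends quota_prog m (7 * n + 19) (\<lambda>m'.
    (\<forall>x. x \<notin> {7, 8, 9, 11} \<and> \<not> (H \<le> x \<and> x < H + n + 2) \<longrightarrow> m' x = m x) \<and>
    (\<forall>k < n + 2. m' (H + k) = \<beta> - card {j. j < n \<and> k < key j}))" (is "ends _ _ _ ?Q")
proof -
  define I where "I i m' \<longleftrightarrow> m' 8 = H + n + 1 - i \<and> m' 7 = n + 2 - i \<and>
    m' 9 = \<beta> - card {j. j < n \<and> n + 2 - i \<le> key j} \<and>
    (\<forall>x. x \<notin> {7, 8, 9, 11} \<and> \<not> (H + (n + 2 - i) \<le> x \<and> x < H + n + 2) \<longrightarrow> m' x = m x) \<and>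
    (\<forall>k. n + 2 - i \<le> k \<and> k < n + 2 \<longrightarrow> m' (H + k) = \<beta> - card {j. j < n \<and> k < key j})"
    for i and m' :: "nat \<Rightarrow> nat"
  have ge: "card {j. j < n \<and> k \<le> key j} = card {j. j < n \<and> Suc k \<le> key j} + card {j. j < n \<and> key j = k}" for k
  proof -
    have "{j. j < n \<and> k \<le> key j} = {j. j < n \<and> Suc k \<le> key j} \<union> {j. j < n \<and> key j = k}" by auto
    then show ?thesis by (simp add: card_Un_disjoint disjoint_iff)
  qed
  have none: "{j. j < n \<and> Suc (Suc n) \<le> key j} = {}" using key by fastforce
  have "ends quota_prog m (4 + ((5 + 2) * (n + 2) + 1)) ?Q"
    unfolding quota_prog_def
  proof (rule ends_Seq)
    show "ends (Block [Add 8 10 2, Add 8 8 0, LoadC 7 2, Add 7 7 2]) m 4 (I 0)"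
      by (rule ends_Block) (use assms(5) in \<open>auto simp: I_def m none\<close>)
    fix m1 assume I0: "I 0 m1"
    show "ends (While 7 (Block [LoadI 11 8, StoreI 8 9, Sub 9 9 11, Sub 8 8 0, Sub 7 7 0])) m1
      ((5 + 2) * (n + 2) + 1) ?Q" (is "ends (While 7 ?c) _ _ _")
    proof (rule ends_While[where I = I], rule I0, rule conjI)
      fix i m' assume i: "i < n + 2" and I: "I i m'"
      show "m' 7 \<noteq> 0" using i I by (simp add: I_def)
      define k where "k = n + 1 - i"
      have k: "n + 2 - i = Suc k" "H + n + 1 - i = H + k" "k < n + 2" "n + 2 - Suc i = k"
        "H + n + 1 - Suc i = H + k - 1"
        using i assms(5) by (auto simp: k_def)
      have r: "m' 8 = H + k" "m' 7 = Suc k" "m' 0 = 1" "m' 9 = \<beta> - card {j. j < n \<and> Suc k \<le> key j}"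
        "m' (H + k) = card {j. j < n \<and> key j = k}"
        and fr: "\<And>x. x \<notin> {7, 8, 9, 11} \<Longrightarrow> \<not> (H + Suc k \<le> x \<and> x < H + n + 2) \<Longrightarrow> m' x = m x"
        and q: "\<And>k'. Suc k \<le> k' \<Longrightarrow> k' < n + 2 \<Longrightarrow> m' (H + k') = \<beta> - card {j. j < n \<and> k' < key j}"
        using I k m assms(5) h[of k] unfolding I_def k(1,2) by auto
      have I_Suc: "I (Suc i) m2 \<longleftrightarrow> m2 8 = H + k - 1 \<and> m2 7 = k \<and>
        m2 9 = \<beta> - card {j. j < n \<and> k \<le> key j} \<and>
        (\<forall>x. x \<notin> {7, 8, 9, 11} \<and> \<not> (H + k \<le> x \<and> x < H + n + 2) \<longrightarrow> m2 x = m x) \<and>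
        (\<forall>k'. k \<le> k' \<and> k' < n + 2 \<longrightarrow> m2 (H + k') = \<beta> - card {j. j < n \<and> k' < key j})" for m2
        unfolding I_def k(4,5) ..
      show "ends ?c m' 5 (I (Suc i))"
        by (rule ends_Block)
          (use k(3) assms(5) ge[of k] in \<open>auto simp: I_Suc r fr q Suc_le_eq\<close>)
    qed (auto simp: I_def)
  qed
  then show ?thesis by (rule ends_mono) simp_all
qed

lemma select_prog_ends:
  assumes m: "m 0 = 1" "m 1 = D" "m 2 = n" "m 10 = H" and "12 < D" "D + 2 * n < H"
    and key: "\<And>j. j < n \<Longrightarrow> m (D + 1 + n + j) = key j" "\<And>j. j < n \<Longrightarrow> key j < L"
    and q: "\<And>k. k < L \<Longrightarrow> m (H + k) = q k"
  shows "ends select_prog m (11 * n + 5) (\<lambda>m'. m' 0 = 1 \<and> m' 1 = D \<and> m' 2 = n \<and>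
    (\<forall>j < n. m' (D + 1 + j) = q (key j) - card {i. i < j \<and> key i = key j}))" (is "ends _ _ _ ?Q")
proof -
  define I where "I i m' \<longleftrightarrow> m' 5 = D + 1 + n + i \<and> m' 6 = D + 1 + i \<and> m' 7 = n - i \<and>
    m' 0 = 1 \<and> m' 1 = D \<and> m' 2 = n \<and> m' 10 = H \<and>
    (\<forall>j < n. m' (D + 1 + n + j) = key j) \<and>
    (\<forall>k < L. m' (H + k) = q k - card {j. j < i \<and> key j = k}) \<and>
    (\<forall>j < i. m' (D + 1 + j) = q (key j) - card {i. i < j \<and> key i = key j})" for i and m' :: "nat \<Rightarrow> nat"
  have "ends select_prog m (4 + ((9 + 2) * n + 1)) ?Q"
    unfolding select_prog_def
  proof (rule ends_Seq)
    show "ends (Block [Add 6 1 0, Add 5 6 2, LoadC 7 0, Add 7 7 2]) m 4 (I 0)"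
      by (rule ends_Block) (use assms in \<open>auto simp: I_def\<close>)
    fix m1 assume I0: "I 0 m1"
    show "ends (While 7 (Block
      [LoadI 8 5, Add 8 8 10, LoadI 11 8, StoreI 6 11, Sub 11 11 0, StoreI 8 11,
       Add 5 5 0, Add 6 6 0, Sub 7 7 0])) m1 ((9 + 2) * n + 1) ?Q" (is "ends (While 7 ?c) _ _ _")
    proof (rule ends_While[where I = I], rule I0, rule conjI)
      fix i m' assume i: "i < n" and I: "I i m'"
      show "m' 7 \<noteq> 0" using i I by (simp add: I_def)
      have r: "m' 5 = D + 1 + n + i" "m' 6 = D + 1 + i" "m' 7 = n - i" "m' 0 = 1" "m' 1 = D"
        "m' 2 = n" "m' 10 = H" "m' (D + 1 + n + i) = key i"
        "m' (H + key i) = q (key i) - card {j. j < i \<and> key j = key i}"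
        and ke: "\<And>j. j < n \<Longrightarrow> m' (D + 1 + n + j) = key j"
        and qu: "\<And>k. k < L \<Longrightarrow> m' (H + k) = q k - card {j. j < i \<and> key j = k}"
        and out: "\<And>j. j < i \<Longrightarrow> m' (D + 1 + j) = q (key j) - card {i. i < j \<and> key i = key j}"
        using I i key by (auto simp: I_def)
      show "ends ?c m' 9 (I (Suc i))"
        by (rule ends_Block)
          (use i assms(5,6) key(2)[OF i] in \<open>auto simp: I_def r[simplified] ke[simplified] qu
            out[simplified] card_Collect_less_Suc add.commute[of _ H] All_less_Suc\<close>)
    qed (auto simp: I_def)
  qed
  then show ?thesis by (rule ends_mono) simp_all
qed

text \<open>Registers 2 to 12 hold input, and only registers 0 and 1 can be used to save them. The address
  \<open>D = 16 n + \<beta>\<close> lies beyond the input and determines \<open>\<beta>\<close> from \<open>n\<close>, so storing \<open>n\<close> there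
  frees register 0. Input cell \<open>a\<close> moves to \<open>D + a - 1\<close>.\<close>

definition save_regs :: "nat \<Rightarrow> instr list" where
  "save_regs k = concat (map (\<lambda>a. [Add 1 1 0, StoreI 1 a]) [2..<2 + k])"

definition load_regs :: "nat \<Rightarrow> instr list" where
  "load_regs k = concat (map (\<lambda>a. [Add 1 1 0, LoadI a 1]) [2..<2 + k])"

definition setup_prog :: com where
  "setup_prog = Seq
    (Block (replicate 16 (Add 1 1 0) @ [StoreI 1 0, LoadC 0 1] @ save_regs 11))
    (Seq (Block [LoadC 2 11, Sub 1 1 2, LoadI 2 1, Add 3 2 2, Add 3 3 3, Add 3 3 3, Add 3 3 3,
      Sub 9 1 3, Add 10 1 3,
      LoadC 5 13, LoadC 6 12, Add 6 6 1, Add 7 2 2, LoadC 8 11, Sub 7 7 8])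
    copy_loop)"

definition restore_prog :: com where
  "restore_prog = Seq (Block [LoadC 5 12, Add 5 5 1, LoadC 6 13, Add 7 2 2, LoadC 8 11, Sub 7 7 8])
    (Seq copy_loop (Block (load_regs 11)))"

definition mes_prog :: com where
  "mes_prog = IfNz 0
    (Seq setup_prog (Seq hist_prog (Seq estar_prog (Seq key_prog (Seq (Block [Add 10 10 3])
      (Seq hist_prog (Seq quota_prog (Seq select_prog restore_prog))))))))"

lemma fold_eff_replicate_Add:
  "fold eff (replicate k (Add 1 1 0)) m = m(1 := m 1 + k * m 0)"
  by (induction k arbitrary: m) (auto simp: fun_eq_iff)

lemma straight_save_regs: "list_all straight (save_regs k)"
  and straight_load_regs: "list_all straight (load_regs k)"
  by (auto simp: save_regs_def load_regs_def list_all_iff)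

lemma length_save_regs: "length (save_regs k) = 2 * k"
  and length_load_regs: "length (load_regs k) = 2 * k"
  by (induction k) (auto simp: save_regs_def load_regs_def)

lemma fold_eff_save_regs:
  assumes "m 0 = 1" "m 1 = D" "k + 1 < D"
  shows "fold eff (save_regs k) m = (\<lambda>x. if x = 1 then D + k
    else if D < x \<and> x \<le> D + k then m (x - D + 1) else m x)"
  using assms(3)
proof (induction k)
  case 0
  then show ?case using assms by (auto simp: save_regs_def)
next
  case (Suc k)
  have "save_regs (Suc k) = save_regs k @ [Add 1 1 0, StoreI 1 (2 + k)]" by (simp add: save_regs_def)
  then show ?case using Suc assms(1) by (auto simp: fun_eq_iff)
qed

lemma fold_eff_load_regs:
  assumes "m 0 = 1" "m 1 = D" "k + 1 < D"
  shows "fold eff (load_regs k) m = (\<lambda>x. if x = 1 then D + k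
    else if 2 \<le> x \<and> x < 2 + k then m (D + x - 1) else m x)"
  using assms(3)
proof (induction k)
  case 0
  then show ?case using assms by (auto simp: load_regs_def)
next
  case (Suc k)
  have "load_regs (Suc k) = load_regs k @ [Add 1 1 0, LoadI (2 + k) 1]" by (simp add: load_regs_def)
  then show ?case using Suc assms(1) by (auto simp: fun_eq_iff)
qed

lemma setup_prog_ends:
  fixes m :: "nat \<Rightarrow> nat"
  assumes "0 < n" and m: "m 0 = n" "m 1 = \<beta>" and zero: "\<And>x. 2 + 2 * n \<le> x \<Longrightarrow> m x = 0"
    and D: "D = 16 * n + \<beta>"
  shows "ends setup_prog m (14 * n + 56) (\<lambda>m'.
    m' 0 = 1 \<and> m' 1 = D \<and> m' 2 = n \<and> m' 3 = 16 * n \<and> m' 9 = \<beta> \<and> m' 10 = D + 16 * n \<and>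
    (\<forall>j < 2 * n. m' (D + 1 + j) = m (2 + j)) \<and> (\<forall>x \<ge> D + 16 * n. m' x = 0))" (is "ends _ _ _ ?Q")
proof -
  define M where "M m' \<longleftrightarrow> m' 0 = 1 \<and> m' 1 = D + 11 \<and> m' D = n \<and>
    (\<forall>x. 2 \<le> x \<and> x \<noteq> D \<longrightarrow> m' x = (if D < x \<and> x \<le> D + 11 then m (x - D + 1) else m x))"
    for m' :: "nat \<Rightarrow> nat"
  define R where "R m' \<longleftrightarrow> m' 0 = 1 \<and> m' 1 = D \<and> m' 2 = n \<and> m' 3 = 16 * n \<and> m' 9 = \<beta> \<and>
    m' 10 = D + 16 * n \<and> m' 5 = 13 \<and> m' 6 = D + 12 \<and> m' 7 = 2 * n - 11 \<and>
    (\<forall>x. 12 < x \<and> x \<noteq> D \<longrightarrow> m' x = (if D < x \<and> x \<le> D + 11 then m (x - D + 1) else m x))"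
    for m' :: "nat \<Rightarrow> nat"
  have D16: "16 \<le> D" using assms by simp
  have "ends setup_prog m (40 + (15 + (7 * (2 * n - 11) + 1))) ?Q"
    unfolding setup_prog_def
  proof (rule ends_Seq)
    show "ends (Block (replicate 16 (Add 1 1 0) @ [StoreI 1 0, LoadC 0 1] @ save_regs 11)) m 40 M"
    proof (rule ends_Block)
      have eq: "fold eff (replicate 16 (Add 1 1 0) @ [StoreI 1 0, LoadC 0 1] @ save_regs 11) m =
          fold eff (save_regs 11) (m(1 := D, D := n, 0 := 1))"
        unfolding fold_append comp_apply fold_eff_replicate_Add
        using D16 by (simp add: m[simplified] D add.commute)
      have "M (fold eff (save_regs 11) (m(1 := D, D := n, 0 := 1)))"
        by (subst fold_eff_save_regs[where D = D]) (use D16 in \<open>auto simp: M_def\<close>)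
      then show "M (fold eff (replicate 16 (Add 1 1 0) @ [StoreI 1 0, LoadC 0 1] @ save_regs 11) m)"
        unfolding eq .
    qed (use straight_save_regs[of 11] in \<open>simp_all add: length_save_regs list_all_iff\<close>)
    fix m1 assume M: "M m1"
    show "ends (Seq (Block [LoadC 2 11, Sub 1 1 2, LoadI 2 1, Add 3 2 2, Add 3 3 3, Add 3 3 3, Add 3 3 3,
      Sub 9 1 3, Add 10 1 3,
      LoadC 5 13, LoadC 6 12, Add 6 6 1, Add 7 2 2, LoadC 8 11, Sub 7 7 8])
      copy_loop) m1 (15 + (7 * (2 * n - 11) + 1)) ?Q"
    proof (rule ends_Seq)
      show "ends (Block [LoadC 2 11, Sub 1 1 2, LoadI 2 1, Add 3 2 2, Add 3 3 3, Add 3 3 3, Add 3 3 3,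
        Sub 9 1 3, Add 10 1 3,
        LoadC 5 13, LoadC 6 12, Add 6 6 1, Add 7 2 2, LoadC 8 11, Sub 7 7 8]) m1 15 R"
        by (rule ends_Block) (use M D16 in \<open>simp_all add: M_def R_def D\<close>)
      fix m2 assume R: "R m2"
      show "ends copy_loop m2 (7 * (2 * n - 11) + 1) ?Q"
      proof (rule ends_mono[OF copy_loop_ends order_refl])
        fix m3
        assume *: "\<forall>x. x \<notin> {5, 6, 7, 8} \<longrightarrow> m3 x =
          (if D + 12 \<le> x \<and> x < D + 12 + (2 * n - 11) then m2 (13 + (x - (D + 12))) else m2 x)"
        have low: "m3 (D + 1 + j) = m (2 + j)" if "j < 2 * n" for j
        proof (cases "j < 11")
          case True
          then show ?thesis using * R D16 by (simp add: R_def)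
        next
          case False
          then have "m3 (D + 1 + j) = m2 (2 + j)" using * that D16 by simp
          then show ?thesis using R False that D by (simp add: R_def)
        qed
        have "m3 x = 0" if "D + 16 * n \<le> x" for x
        proof -
          have "\<not> x < D + 12 + (2 * n - 11)" "\<not> x \<le> D + 11" "12 < x" "x \<noteq> D" "2 + 2 * n \<le> x"
            using that D assms(1) by linarith+
          then show ?thesis using * R zero[of x] by (simp add: R_def)
        qed
        with low show "?Q m3" using * R D16 by (simp add: R_def)
      qed (use R D D16 assms(1) in \<open>auto simp: R_def\<close>)
    qed
  qed
  then show ?thesis by (rule ends_mono) simp_all
qed

lemma restore_prog_ends:
  assumes m: "m 0 = 1" "m 1 = D" "m 2 = n" and D: "16 * n \<le> D" "16 \<le> D"
    and out: "\<And>j. j < n \<Longrightarrow> m (D + 1 + j) = r j"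
  shows "ends restore_prog m (14 * n + 29) (\<lambda>m'. \<forall>j < n. m' (2 + j) = r j)" (is "ends _ _ _ ?Q")
proof -
  define R where "R m' \<longleftrightarrow> m' 0 = 1 \<and> m' 1 = D \<and> m' 5 = D + 12 \<and> m' 6 = 13 \<and> m' 7 = 2 * n - 11 \<and>
    (\<forall>x. 12 < x \<longrightarrow> m' x = m x)" for m' :: "nat \<Rightarrow> nat"
  define C where "C m' \<longleftrightarrow> m' 0 = 1 \<and> m' 1 = D \<and>
    (\<forall>x. 12 < x \<and> x < 2 + n \<longrightarrow> m' x = r (x - 2)) \<and> (\<forall>x \<ge> D. m' x = m x)" for m' :: "nat \<Rightarrow> nat"
  have "ends restore_prog m (6 + ((7 * (2 * n - 11) + 1) + 22)) ?Q"
    unfolding restore_prog_def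
  proof (intro ends_Seq)
    show "ends (Block [LoadC 5 12, Add 5 5 1, LoadC 6 13, Add 7 2 2, LoadC 8 11, Sub 7 7 8]) m 6 R"
      by (rule ends_Block) (use m D in \<open>auto simp: R_def\<close>)
    fix m1 assume R: "R m1"
    show "ends copy_loop m1 (7 * (2 * n - 11) + 1) C"
    proof (rule ends_mono[OF copy_loop_ends order_refl])
      fix m2
      assume *: "\<forall>x. x \<notin> {5, 6, 7, 8} \<longrightarrow> m2 x =
        (if 13 \<le> x \<and> x < 13 + (2 * n - 11) then m1 (D + 12 + (x - 13)) else m1 x)"
      have "m2 x = r (x - 2)" if "12 < x" "x < 2 + n" for x
      proof -
        have "D + 12 + (x - 13) = D + 1 + (x - 2)" using that by simp
        moreover have "m2 x = m1 (D + 12 + (x - 13))" using * that by simp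
        ultimately have "m2 x = m1 (D + 1 + (x - 2))" by (simp only:)
        then show ?thesis using R D that out[of "x - 2"] by (simp add: R_def)
      qed
      moreover have "m2 x = m x" if "D \<le> x" for x
      proof -
        have "\<not> x < 13 + (2 * n - 11)" using D that by linarith
        then show ?thesis using * R D that by (simp add: R_def)
      qed
      moreover have "m2 0 = 1" "m2 1 = D" using * R by (simp_all add: R_def)
      ultimately show "C m2" by (simp add: C_def)
    qed (use R D in \<open>auto simp: R_def\<close>)
  next
    fix m2 assume C: "C m2"
    have "fold eff (load_regs 11) m2 (2 + j) = r j" if "j < n" for j
    proof -
      have "fold eff (load_regs 11) m2 (2 + j) = (if j < 11 then m2 (D + 1 + j) else m2 (2 + j))"
        by (subst fold_eff_load_regs[where D = D]) (use C D in \<open>auto simp: C_def\<close>)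
      then show ?thesis using C that out[OF that] by (simp add: C_def)
    qed
    then show "ends (Block (load_regs 11)) m2 22 ?Q"
      by (intro ends_Block) (simp_all add: straight_load_regs length_load_regs)
  qed
  then show ?thesis by (rule ends_mono) simp_all
qed

lemma mes_prog_ends:
  assumes t: "\<forall>v < n. tI v \<le> tE v \<and> tE v \<le> card (complete_nbrs n v) + 1"
  shows "ends mes_prog (snd (mes_input n \<beta> tI tE)) (100 * n + 200)
    (\<lambda>m. is_MES_solution {0..<n} (complete_nbrs n) tI tE \<beta> (mes_output n (pc, m)))"
    (is "ends _ ?m0 _ ?Q")
proof (cases "n = 0")
  case True
  have "mes_output n c = {}" for c using True by (simp add: mes_output_def)
  moreover have "is_MES_solution {0..<n} (complete_nbrs n) tI tE \<beta> {}"
    using True by (simp add: is_MES_solution_def)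
  ultimately have "?Q m" for m by simp
  then have "ends mes_prog ?m0 (Suc 0) ?Q"
    unfolding mes_prog_def using True by (intro ends_IfNz) (auto simp: mes_input_def)
  then show ?thesis by (rule ends_mono) simp_all
next
  case False
  then have n: "0 < n" by simp
  have tE: "tI v \<le> tE v \<and> tE v \<le> n" if "v < n" for v
  proof -
    have "card (complete_nbrs n v) = n - 1" using that by (simp add: complete_nbrs_def)
    then show ?thesis using t that by fastforce
  qed
  define D where "D = 16 * n + \<beta>"
  have D: "16 * n \<le> D" "16 \<le> D" using n by (auto simp: D_def)
  define regs where "regs m \<longleftrightarrow> m 0 = 1 \<and> m 1 = D \<and> m 2 = n \<and> m 3 = 16 * n \<and> m 9 = \<beta>"
    for m :: "nat \<Rightarrow> nat"
  define key where "key e v = (if tI v \<le> e then tE v else Suc n)" for e v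
  define opt where "opt e \<longleftrightarrow> e \<le> n \<and> (e = n \<or> \<beta> + card {v. v < n \<and> tE v \<le> e} \<le> e) \<and>
    (\<forall>k < e. k < \<beta> + card {v. v < n \<and> tE v \<le> k})" for e
  define tI_at where "tI_at m \<longleftrightarrow> (\<forall>j < n. m (D + 1 + j) = tI j)" for m :: "nat \<Rightarrow> nat"
  define at where "at m f \<longleftrightarrow> (\<forall>j < n. m (D + 1 + n + j) = f j)" for m f :: "nat \<Rightarrow> nat"
  define free where "free m \<longleftrightarrow> (\<forall>x \<ge> D + 32 * n. m x = 0)" for m :: "nat \<Rightarrow> nat"
  have key: "key e v \<le> Suc n" if "v < n" for e v using tE[OF that] by (simp add: key_def)
  define P1 where "P1 m \<longleftrightarrow> regs m \<and> m 10 = D + 16 * n \<and> tI_at m \<and> at m tE \<and>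
    (\<forall>x \<ge> D + 16 * n. m x = 0)" for m
  define P2 where "P2 m \<longleftrightarrow> regs m \<and> m 10 = D + 16 * n \<and> tI_at m \<and> at m tE \<and> free m \<and>
    (\<forall>k \<le> n. m (D + 16 * n + k) = card {j. j < n \<and> tE j = k})" for m
  define P3 where "P3 m \<longleftrightarrow> regs m \<and> m 10 = D + 16 * n \<and> tI_at m \<and> at m tE \<and> free m \<and> opt (m 12)" for m
  define P4 where "P4 h m \<longleftrightarrow> regs m \<and> m 10 = D + h * n \<and> free m \<and> opt (m 12) \<and> at m (key (m 12))" for h m
  define P6 where "P6 m \<longleftrightarrow> regs m \<and> m 10 = D + 32 * n \<and> opt (m 12) \<and> at m (key (m 12)) \<and>
    (\<forall>k < n + 2. m (D + 32 * n + k) = card {j. j < n \<and> key (m 12) j = k})" for m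
  define P7 where "P7 m \<longleftrightarrow> m 0 = 1 \<and> m 1 = D \<and> m 2 = n \<and> m 10 = D + 32 * n \<and> opt (m 12) \<and>
    at m (key (m 12)) \<and>
    (\<forall>k < n + 2. m (D + 32 * n + k) = \<beta> - card {j. j < n \<and> k < key (m 12) j})" for m
  define P8 where "P8 m \<longleftrightarrow> m 0 = 1 \<and> m 1 = D \<and> m 2 = n \<and>
    (\<exists>e. opt e \<and> (\<forall>j < n. m (D + 1 + j) = \<beta> - rank n (key e) j))" for m :: "nat \<Rightarrow> nat"
  have "ends mes_prog ?m0 (Suc ((14 * n + 56) + ((9 * n + 5) + ((9 * n + 6) + ((11 * n + 5) +
    (1 + ((9 * n + 5) + ((7 * n + 19) + ((11 * n + 5) + (14 * n + 29)))))))))) ?Q"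
    unfolding mes_prog_def
  proof (intro ends_IfNz ends_Seq)
    assume "?m0 0 = 0"
    then show "?Q ?m0" using n by (simp add: mes_input_def)
  next
    have input: "?m0 (2 + j) = (if j < n then tI j else tE (j - n))" if "j < 2 * n" for j
      using that by (auto simp: mes_input_def)
    show "ends setup_prog ?m0 (14 * n + 56) P1"
    proof (rule ends_mono[OF setup_prog_ends[OF n _ _ _ D_def] order_refl])
      fix m assume "m 0 = 1 \<and> m 1 = D \<and> m 2 = n \<and> m 3 = 16 * n \<and> m 9 = \<beta> \<and> m 10 = D + 16 * n \<and>
        (\<forall>j < 2 * n. m (D + 1 + j) = ?m0 (2 + j)) \<and> (\<forall>x \<ge> D + 16 * n. m x = 0)"
      moreover from this have "m (D + 1 + n + j) = tE j" if "j < n" for j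
        using that input[of "n + j"] by (simp add: add.assoc)
      ultimately show "P1 m" using input
        by (simp add: P1_def regs_def tI_at_def at_def)
    qed (auto simp: mes_input_def)
  next
    fix m assume m: "P1 m"
    show "ends hist_prog m (9 * n + 5) P2"
    proof (rule ends_mono[OF hist_prog_ends[of m D n "D + 16 * n" tE "Suc n"] order_refl])
      show "tE j < Suc n" if "j < n" for j using tE[OF that] by simp
    qed (use m D n in \<open>auto simp: P1_def P2_def regs_def tI_at_def at_def free_def less_Suc_eq_le\<close>)
  next
    fix m assume m: "P2 m"
    show "ends estar_prog m (9 * n + 6) P3"
      by (rule ends_mono[OF estar_prog_ends[of m n \<beta> "D + 16 * n" tE] order_refl])
        (use m D n in \<open>auto simp: P2_def P3_def regs_def tI_at_def at_def free_def opt_def\<close>)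
  next
    fix m assume m: "P3 m"
    show "ends key_prog m (11 * n + 5) (P4 16)"
      by (rule ends_mono[OF key_prog_ends[of m D n "m 12" tI tE] order_refl])
        (use m D n in \<open>auto simp: P3_def P4_def regs_def tI_at_def at_def free_def key_def\<close>)
  next
    fix m assume m: "P4 16 m"
    show "ends (Block [Add 10 10 3]) m 1 (P4 32)"
      by (rule ends_Block) (use m D n in \<open>auto simp: P4_def regs_def at_def free_def\<close>)
  next
    fix m assume m: "P4 32 m"
    show "ends hist_prog m (9 * n + 5) P6"
    proof (rule ends_mono[OF hist_prog_ends[of m D n "D + 32 * n" "key (m 12)" "n + 2"] order_refl])
      show "key (m 12) j < n + 2" if "j < n" for j using key[OF that, of "m 12"] by simp
    qed (use m D n in \<open>auto simp: P4_def P6_def regs_def at_def free_def\<close>)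
  next
    fix m assume m: "P6 m"
    show "ends quota_prog m (7 * n + 19) P7"
      by (rule ends_mono[OF quota_prog_ends[of m n \<beta> "D + 32 * n" "key (m 12)"] order_refl])
        (use m D n key in \<open>auto simp: P6_def P7_def regs_def at_def\<close>)
  next
    fix m assume m: "P7 m"
    let ?q = "\<lambda>k. \<beta> - card {j. j < n \<and> k < key (m 12) j}"
    show "ends select_prog m (11 * n + 5) P8"
    proof (rule ends_mono[OF select_prog_ends[of m D n "D + 32 * n" "key (m 12)" "n + 2" ?q] order_refl])
      show "key (m 12) j < n + 2" if "j < n" for j using key[OF that, of "m 12"] by simp
      fix m' assume "m' 0 = 1 \<and> m' 1 = D \<and> m' 2 = n \<and> (\<forall>j < n. m' (D + 1 + j) =
        ?q (key (m 12) j) - card {i. i < j \<and> key (m 12) i = key (m 12) j})"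
      then show "P8 m'" using m
        by (auto simp: P7_def P8_def rank_eq intro!: exI[of _ "m 12"])
    qed (use m D n in \<open>auto simp: P7_def at_def\<close>)
  next
    fix m assume m: "P8 m"
    then obtain e where e: "opt e" "\<And>j. j < n \<Longrightarrow> m (D + 1 + j) = \<beta> - rank n (key e) j"
      by (auto simp: P8_def)
    show "ends restore_prog m (14 * n + 29) ?Q"
    proof (rule ends_mono[OF restore_prog_ends[of m D n "\<lambda>j. \<beta> - rank n (key e) j"] order_refl])
      fix m' assume "\<forall>j < n. m' (2 + j) = \<beta> - rank n (key e) j"
      then have "mes_output n (pc, m') = {j. j < n \<and> rank n (key e) j < \<beta>}"
        by (auto simp: mes_output_def)
      then show "?Q m'"
        using is_MES_solution_rank_less[of n tI tE e \<beta> "key e"] tE e(1) by (auto simp: opt_def key_def)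
    qed (use m D e in \<open>auto simp: P8_def\<close>)
  qed
  then show ?thesis by (rule ends_mono) simp_all
qed

theorem theorem5:
  shows "\<exists>(P :: instr list) (c :: nat).
    \<forall>(n :: nat) (\<beta> :: nat) (tI :: nat \<Rightarrow> nat) (tE :: nat \<Rightarrow> nat).
      (\<forall>v < n. tI v \<le> tE v \<and> tE v \<le> card (complete_nbrs n v) + 1) \<longrightarrow>
      (\<exists>k \<le> c * n + c.
         halted P (run P k (mes_input n \<beta> tI tE)) \<and>
         is_MES_solution {0..<n} (complete_nbrs n) tI tE \<beta>
           (mes_output n (run P k (mes_input n \<beta> tI tE))))"
proof (rule exI[of _ "compile mes_prog 0"], rule exI[of _ 200], intro allI impI)
  fix n \<beta> :: nat and tI tE :: "nat \<Rightarrow> nat"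
  assume "\<forall>v < n. tI v \<le> tE v \<and> tE v \<le> card (complete_nbrs n v) + 1"
  from mes_prog_ends[OF this, of \<beta> "csize mes_prog"] obtain k m
    where k: "k \<le> 100 * n + 200" and big: "big mes_prog (snd (mes_input n \<beta> tI tE)) k m"
      and m: "is_MES_solution {0..<n} (complete_nbrs n) tI tE \<beta> (mes_output n (csize mes_prog, m))"
    unfolding ends_def by blast
  have "mes_input n \<beta> tI tE = (0, snd (mes_input n \<beta> tI tE))" by (simp add: mes_input_def)
  then have run: "run (compile mes_prog 0) k (mes_input n \<beta> tI tE) = (csize mes_prog, m)"
    using compile_correct[OF big, of "[]" "[]"] by simp
  show "\<exists>k \<le> 200 * n + 200. halted (compile mes_prog 0) (run (compile mes_prog 0) k (mes_input n \<beta> tI tE)) \<and>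
    is_MES_solution {0..<n} (complete_nbrs n) tI tE \<beta>
      (mes_output n (run (compile mes_prog 0) k (mes_input n \<beta> tI tE)))"
    using k m by (intro exI[of _ k]) (simp add: run halted_def)
qed

end
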